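(* Let $X$ be an infinite dimensional separable Banach space and $T:X\to X$ a continuous linear operator. Then $(X,T)$ is weakly mixing if and only if it is weakly transitive compact.
   Context: "Opene" means open and nonempty. $N_T(U,V)=\{n\in\mathbb{Z}_+:U\cap T^{-n}V\neq\varnothing\}$, $n_T(x,G)=\{n\in\mathbb{Z}_+:T^nx\in G\}$. $(X,T)$ is weakly mixing if $T\times T$ is topologically transitive on $X\times X$, i.e. $N_{T\times T}(A,B)\neq\varnothing$ for all opene $A,B\subset X\times X$. $(X,T)$ is weakly transitive compact if there is a dense subset $X_0\subset X$ such that for every $x\in X_0$ there exists $z\in X$ with $n_T(x,G)\cap N_T(U,V)\neq\varnothing$ for every neighbourhood $G$ of $z$ and all opene $U,V\subset X$. *)

theory Defs
  imports "HOL-Analysis.Analysis"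
begin

definition opene :: "'a::topological_space set \<Rightarrow> bool" where
  "opene U \<longleftrightarrow> open U \<and> U \<noteq> {}"

text \<open>Z_+ is read as the nonnegative integers, rendered as nat.\<close>
definition return_times :: "('a \<Rightarrow> 'a) \<Rightarrow> 'a set \<Rightarrow> 'a set \<Rightarrow> nat set" where
  "return_times T U V = {n. U \<inter> (T ^^ n) -` V \<noteq> {}}"

definition visit_times :: "('a \<Rightarrow> 'a) \<Rightarrow> 'a \<Rightarrow> 'a set \<Rightarrow> nat set" where
  "visit_times T x G = {n. (T ^^ n) x \<in> G}"

definition prod_map :: "('a \<Rightarrow> 'a) \<Rightarrow> ('a \<times> 'a \<Rightarrow> 'a \<times> 'a)" where
  "prod_map T = (\<lambda>(x, y). (T x, T y))"

definition weakly_mixing :: "('a::topological_space \<Rightarrow> 'a) \<Rightarrow> bool" where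
  "weakly_mixing T \<longleftrightarrow>
     (\<forall>A B :: ('a \<times> 'a) set. opene A \<and> opene B \<longrightarrow> return_times (prod_map T) A B \<noteq> {})"

definition weakly_transitive_compact :: "('a::topological_space \<Rightarrow> 'a) \<Rightarrow> bool" where
  "weakly_transitive_compact T \<longleftrightarrow>
     (\<exists>X0. closure X0 = UNIV \<and>
        (\<forall>x\<in>X0. \<exists>z. \<forall>G U V. (\<exists>W. open W \<and> z \<in> W \<and> W \<subseteq> G) \<and> opene U \<and> opene V
            \<longrightarrow> visit_times T x G \<inter> return_times T U V \<noteq> {}))"

definition separable_type :: "'a::topological_space itself \<Rightarrow> bool" where
  "separable_type _ \<longleftrightarrow> (\<exists>D :: 'a set. countable D \<and> closure D = UNIV)"

definition infinite_dimensional :: "'a::real_vector itself \<Rightarrow> bool" where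
  "infinite_dimensional _ \<longleftrightarrow> \<not> (\<exists>B :: 'a set. finite B \<and> span B = UNIV)"

end

theory Submission
  imports Defs
begin

text \<open>
  If \<open>T\<close> is weakly mixing, then for every fixed \<open>z\<close> the points \<open>x\<close> whose visits to each
  neighbourhood of \<open>z\<close> meet each return time set form a residual set, by Baire's theorem.

  Conversely, let \<open>T\<close> be weakly transitive compact; in particular \<open>T\<close> is transitive. Given opene
  \<open>U\<close>, \<open>V\<close> and a neighbourhood \<open>W\<close> of \<open>0\<close>, pick \<open>x \<in> U\<close> with its \<open>z\<close>, and \<open>m\<close> such that
  \<open>T ^^ m\<close> maps some point near \<open>z\<close> into \<open>V\<close>. There are \<open>n\<close> and a small \<open>u\<close>
  with \<open>T ^^ m\<close> mapping \<open>u\<close> into \<open>W\<close>, with \<open>T ^^ n\<close> mapping both \<open>x\<close> and \<open>u\<close> near \<open>z\<close>, and with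
  \<open>T ^^ (n + m)\<close> mapping \<open>u\<close> into \<open>V\<close>. By linearity \<open>T ^^ n\<close> maps \<open>x - u \<in> U\<close> into \<open>W\<close>, and it
  maps \<open>(T ^^ m) u \<in> W\<close> into \<open>V\<close>. Combined with transitivity, this yields weak mixing.
\<close>

section \<open>Return times and iterates of a linear operator\<close>

lemma in_return_times_iff: "n \<in> return_times T U V \<longleftrightarrow> (\<exists>u\<in>U. (T ^^ n) u \<in> V)"
  by (auto simp: return_times_def)

lemma return_times_nonempty_iff:
  "return_times T U V \<noteq> {} \<longleftrightarrow> (\<exists>n. \<exists>u\<in>U. (T ^^ n) u \<in> V)"
  unfolding return_times_def by blast

lemma return_times_Int_nonempty_iff:
  "return_times T U1 V1 \<inter> return_times T U2 V2 \<noteq> {} \<longleftrightarrow>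
    (\<exists>n. (\<exists>u\<in>U1. (T ^^ n) u \<in> V1) \<and> (\<exists>u\<in>U2. (T ^^ n) u \<in> V2))"
  unfolding return_times_def by blast

lemma opene_ball: "0 < e \<Longrightarrow> opene (ball x e)"
  for x :: "'a::metric_space"
  by (auto simp: opene_def)

lemma funpow_prod_map: "(prod_map T ^^ n) (x, y) = ((T ^^ n) x, (T ^^ n) y)"
  by (induction n) (auto simp: prod_map_def)

lemma bounded_linear_funpow:
  fixes T :: "'a::real_normed_vector \<Rightarrow> 'a"
  assumes "bounded_linear T"
  shows "bounded_linear (T ^^ n)"
proof (induction n)
  case 0
  show ?case by (simp add: id_def)
next
  case (Suc n)
  then show ?case
    using bounded_linear_compose[OF assms Suc] by (simp add: o_def)
qed

lemma open_vimage_funpow: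
  fixes T :: "'a::real_normed_vector \<Rightarrow> 'a"
  assumes "bounded_linear T" "open V"
  shows "open ((T ^^ n) -` V)"
  using assms by (intro open_vimage bounded_linear_funpow linear_continuous_on)

lemma funpow_commute: "(T ^^ n) ((T ^^ m) x) = (T ^^ m) ((T ^^ n) x)"
  by (metis add.commute comp_apply funpow_add)

text \<open>Every opene subset of the product contains an opene box, and iterates of
  \<open>prod_map T\<close> act coordinatewise, so testing boxes is enough.\<close>

lemma weakly_mixing_iff:
  fixes T :: "'a::topological_space \<Rightarrow> 'a"
  shows "weakly_mixing T \<longleftrightarrow> (\<forall>U1 V1 U2 V2. opene U1 \<and> opene V1 \<and> opene U2 \<and> opene V2
    \<longrightarrow> return_times T U1 V1 \<inter> return_times T U2 V2 \<noteq> {})"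
proof (intro iffI allI impI)
  fix U1 V1 U2 V2 :: "'a set"
  assume wm: "weakly_mixing T" and "opene U1 \<and> opene V1 \<and> opene U2 \<and> opene V2"
  then have "opene (U1 \<times> U2)" "opene (V1 \<times> V2)"
    by (auto simp: opene_def intro: open_Times)
  with wm obtain n where "n \<in> return_times (prod_map T) (U1 \<times> U2) (V1 \<times> V2)"
    by (auto simp: weakly_mixing_def)
  then show "return_times T U1 V1 \<inter> return_times T U2 V2 \<noteq> {}"
    unfolding return_times_Int_nonempty_iff
    by (auto simp: in_return_times_iff funpow_prod_map)
next
  assume R: "\<forall>U1 V1 U2 V2 :: 'a set. opene U1 \<and> opene V1 \<and> opene U2 \<and> opene V2
    \<longrightarrow> return_times T U1 V1 \<inter> return_times T U2 V2 \<noteq> {}"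
  have "return_times (prod_map T) A B \<noteq> {}" if "opene A" "opene B" for A B :: "('a \<times> 'a) set"
  proof -
    have rect: "\<exists>P Q. opene P \<and> opene Q \<and> P \<times> Q \<subseteq> C" if C: "opene C" for C :: "('a \<times> 'a) set"
    proof -
      obtain c where "c \<in> C" "open C"
        using C unfolding opene_def by blast
      then obtain P Q where "open P" "open Q" "c \<in> P \<times> Q" "P \<times> Q \<subseteq> C"
        by (metis open_prod_elim)
      then show ?thesis
        by (auto simp: opene_def)
    qed
    obtain U1 U2 where U: "opene U1" "opene U2" "U1 \<times> U2 \<subseteq> A"
      using rect[OF \<open>opene A\<close>] by blast
    obtain V1 V2 where V: "opene V1" "opene V2" "V1 \<times> V2 \<subseteq> B"
      using rect[OF \<open>opene B\<close>] by blast
    obtain n where "n \<in> return_times T U1 V1" "n \<in> return_times T U2 V2"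
      using R U V by blast
    then obtain u v where "u \<in> U1" "v \<in> U2" "(T ^^ n) u \<in> V1" "(T ^^ n) v \<in> V2"
      by (auto simp: in_return_times_iff)
    with U V have "(u, v) \<in> A" "(prod_map T ^^ n) (u, v) \<in> B"
      by (auto simp: funpow_prod_map)
    then show ?thesis
      using in_return_times_iff by (metis empty_iff)
  qed
  then show "weakly_mixing T"
    by (auto simp: weakly_mixing_def)
qed

section \<open>From weak mixing to weak transitive compactness, by Baire category\<close>

text \<open>Balls of radius 1/(k+1) about a countable dense set do the job. It reduces all opene
  pairs to countably many, as Baire's theorem requires.\<close>

lemma separable_type_countable_pi_base:
  assumes "separable_type TYPE('a::metric_space)"
  obtains \<B> :: "'a::metric_space set set" where "countable \<B>" "\<And>B. B \<in> \<B> \<Longrightarrow> opene B"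
    "\<And>U. opene U \<Longrightarrow> \<exists>B\<in>\<B>. B \<subseteq> U"
proof -
  obtain D :: "'a set" where D: "countable D" "closure D = UNIV"
    using assms by (auto simp: separable_type_def)
  define \<B> where "\<B> = (\<lambda>(d, k). ball d (inverse (real (Suc k)))) ` (D \<times> UNIV)"
  show ?thesis
  proof
    show "countable \<B>"
      using D by (simp add: \<B>_def)
    show "opene B" if "B \<in> \<B>" for B
      using that by (auto simp: \<B>_def simp del: of_nat_Suc intro!: opene_ball)
    show "\<exists>B\<in>\<B>. B \<subseteq> U" if U: "opene U" for U
    proof -
      have "U \<inter> D \<noteq> {}"
        using U D open_Int_closure_eq_empty[of U D] by (auto simp: opene_def)
      then obtain d where d: "d \<in> U" "d \<in> D" by auto
      then obtain e where e: "0 < e" "ball d e \<subseteq> U"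
        using U unfolding opene_def by (metis openE)
      obtain k where "inverse (real (Suc k)) < e"
        using reals_Archimedean e by blast
      then have "ball d (inverse (real (Suc k))) \<subseteq> U"
        using e by (meson less_imp_le subset_ball subset_trans)
      then show ?thesis
        using d by (force simp: \<B>_def)
    qed
  qed
qed

lemma weakly_transitive_compact_if_weakly_mixing:
  fixes T :: "'a::banach \<Rightarrow> 'a"
  assumes "separable_type TYPE('a)" "bounded_linear T" and wm: "weakly_mixing T"
  shows "weakly_transitive_compact T"
proof -
  obtain \<B> :: "'a set set" where \<B>: "countable \<B>" "\<And>B. B \<in> \<B> \<Longrightarrow> opene B"
    "\<And>U. opene U \<Longrightarrow> \<exists>B\<in>\<B>. B \<subseteq> U"
    using separable_type_countable_pi_base[OF assms(1)] by blast
  \<comment> \<open>Points that enter the ball of radius 1/(k+1) about 0 at some return time from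
    \<open>U\<close> to \<open>V\<close>. The single choice \<open>z = 0\<close> will serve every
    point of \<open>X0\<close>.\<close>
  define hits where "hits = (\<lambda>(U, V, k). \<Union>n\<in>return_times T U V.
    (T ^^ n) -` ball 0 (inverse (real (Suc k))))"
  define X0 where "X0 = (\<Inter>p\<in>\<B> \<times> \<B> \<times> UNIV. hits p)"
  have dense: "closure X0 = UNIV"
  proof -
    have "Met_TC.mtopology closure_of (\<Inter>(hits ` (\<B> \<times> \<B> \<times> UNIV))) = UNIV"
    proof (rule Met_TC.metric_Baire_category)
      show "Met_TC.mcomplete TYPE('a)"
        using complete_UNIV by simp
      show "countable (hits ` (\<B> \<times> \<B> \<times> UNIV))"
        using \<B>(1) by simp
      fix S assume "S \<in> hits ` (\<B> \<times> \<B> \<times> UNIV)"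
      then obtain U V k where UV: "U \<in> \<B>" "V \<in> \<B>" and S: "S = hits (U, V, k)"
        by auto
      have "open S"
        unfolding S hits_def using assms(2) by (auto intro!: open_vimage_funpow)
      \<comment> \<open>Weak mixing gives one time that is a return time for both
        \<open>(U, V)\<close> and \<open>W\<close> with the small ball.\<close>
      moreover have "S \<inter> W \<noteq> {}" if "opene W" for W
      proof -
        have "opene (ball (0::'a) (inverse (real (Suc k))))"
          by (rule opene_ball) simp
        then have "return_times T U V \<inter> return_times T W (ball 0 (inverse (real (Suc k)))) \<noteq> {}"
          using wm UV[THEN \<B>(2)] that unfolding weakly_mixing_iff by blast
        then obtain n w where "n \<in> return_times T U V" "w \<in> W"
          "(T ^^ n) w \<in> ball 0 (inverse (real (Suc k)))"
          unfolding return_times_Int_nonempty_iff in_return_times_iff by blast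
        then have "w \<in> S \<inter> W"
          by (auto simp: S hits_def)
        then show ?thesis by blast
      qed
      \<comment> \<open>The complement of \<open>closure S\<close> is open and misses
        \<open>S\<close>, hence is empty.\<close>
      then have "closure S = UNIV"
        using closure_subset[of S] unfolding opene_def
        by (metis Compl_disjoint2 Compl_empty_eq Int_mono closed_closure double_compl open_Compl
            subset_empty subset_refl)
      ultimately show "openin Met_TC.mtopology S \<and> Met_TC.mtopology closure_of S = UNIV"
        by simp
    qed
    then show ?thesis
      by (auto simp: X0_def)
  qed
  have "visit_times T x G \<inter> return_times T U V \<noteq> {}"
    if x: "x \<in> X0" and G: "open W" "0 \<in> W" "W \<subseteq> G" and UV: "opene U" "opene V" for x G U V W
  proof -
    \<comment> \<open>Shrinking \<open>U\<close>, \<open>V\<close> and \<open>G\<close> only removes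
      times, so members of the countable family suffice.\<close>
    obtain U' V' where U': "U' \<in> \<B>" "U' \<subseteq> U" and V': "V' \<in> \<B>" "V' \<subseteq> V"
      using \<B>(3) UV by meson
    obtain e where e: "0 < e" "ball 0 e \<subseteq> W"
      using G by (meson openE)
    obtain k where k: "inverse (real (Suc k)) < e"
      using reals_Archimedean e by blast
    have "x \<in> hits (U', V', k)"
      using x U' V' by (auto simp: X0_def)
    then obtain n where n: "n \<in> return_times T U' V'" "(T ^^ n) x \<in> ball 0 (inverse (real (Suc k)))"
      by (auto simp: hits_def)
    have "(T ^^ n) x \<in> G"
      using n(2) k e G by (auto intro!: subsetD[OF G(3)] subsetD[OF e(2)] simp del: of_nat_Suc)
    moreover have "n \<in> return_times T U V"
      using n(1) U' V' by (auto simp: in_return_times_iff)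
    ultimately show ?thesis
      by (auto simp: visit_times_def)
  qed
  then have "\<forall>x\<in>X0. \<forall>G U V. (\<exists>W. open W \<and> 0 \<in> W \<and> W \<subseteq> G) \<and> opene U \<and> opene V
      \<longrightarrow> visit_times T x G \<inter> return_times T U V \<noteq> {}"
    by blast
  with dense show ?thesis
    unfolding weakly_transitive_compact_def by (intro exI[of _ X0] conjI ballI exI[of _ 0]) auto
qed

section \<open>From weak transitive compactness to weak mixing\<close>

lemma weakly_transitive_compactE:
  assumes "weakly_transitive_compact T" "opene S"
  obtains x z where "x \<in> S" "\<forall>G U V. open G \<and> z \<in> G \<and> opene U \<and> opene V \<longrightarrow>
      visit_times T x G \<inter> return_times T U V \<noteq> {}"
proof -
  obtain X0 where X0: "closure X0 = UNIV"
    and z: "\<forall>x\<in>X0. \<exists>z. \<forall>G U V. (\<exists>W. open W \<and> z \<in> W \<and> W \<subseteq> G) \<and> opene U \<and> opene V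
       \<longrightarrow> visit_times T x G \<inter> return_times T U V \<noteq> {}"
    using assms(1) unfolding weakly_transitive_compact_def by (elim exE conjE)
  have "S \<inter> X0 \<noteq> {}"
    using assms(2) X0 open_Int_closure_eq_empty[of S X0] by (simp add: opene_def)
  then obtain x where x: "x \<in> S" "x \<in> X0" by auto
  from bspec[OF z x(2)] obtain z where
    z: "\<forall>G U V. (\<exists>W. open W \<and> z \<in> W \<and> W \<subseteq> G) \<and> opene U \<and> opene V
       \<longrightarrow> visit_times T x G \<inter> return_times T U V \<noteq> {}"
    by (elim exE)
  show ?thesis
    using z by (intro that[OF x(1)]) blast
qed

text \<open>With \<open>G = UNIV\<close> the condition on visits is vacuous.\<close>

lemma transitive_if_weakly_transitive_compact:
  assumes "weakly_transitive_compact T" "opene U" "opene V"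
  shows "return_times T U V \<noteq> {}"
proof -
  obtain x z where "\<forall>G U V. open G \<and> z \<in> G \<and> opene U \<and> opene V \<longrightarrow>
      visit_times T x G \<inter> return_times T U V \<noteq> {}"
    by (rule weakly_transitive_compactE[OF assms(1,2)])
  then have "visit_times T x UNIV \<inter> return_times T U V \<noteq> {}"
    using assms(2,3) by simp
  then show ?thesis
    by auto
qed

lemma three_open_sets_if_weakly_transitive_compact:
  fixes T :: "'a::real_normed_vector \<Rightarrow> 'a"
  assumes T: "bounded_linear T" and wtc: "weakly_transitive_compact T"
    and U: "opene U" and V: "opene V" and W: "open W" "0 \<in> W"
  shows "return_times T U W \<inter> return_times T W V \<noteq> {}"
proof -
  obtain x z where x: "x \<in> U" and z: "\<forall>G U V. open G \<and> z \<in> G \<and> opene U \<and> opene V \<longrightarrow>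
      visit_times T x G \<inter> return_times T U V \<noteq> {}"
    by (rule weakly_transitive_compactE[OF wtc U])
  obtain d where d: "0 < d" "ball x d \<subseteq> U"
    using U x by (meson opene_def openE)
  obtain e where e: "0 < e" "ball 0 e \<subseteq> W"
    using W by (meson openE)
  \<comment> \<open>The radius is halved because two points in this ball differ by less than
    \<open>e\<close>; taking their difference removes the unknown \<open>z\<close>.\<close>
  have "return_times T (ball z (e/2)) V \<noteq> {}"
    using transitive_if_weakly_transitive_compact[OF wtc opene_ball V] e by simp
  then obtain m y where y: "y \<in> ball z (e/2)" "(T ^^ m) y \<in> V"
    unfolding return_times_nonempty_iff by blast
  have T0: "(T ^^ m) 0 = 0"
    using bounded_linear_funpow[OF T] by (simp add: linear_simps)
  \<comment> \<open>The ball keeps \<open>x - u\<close> in \<open>U\<close>; the preimage makes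
    \<open>(T ^^ m) u\<close> a starting point in \<open>W\<close>. Likewise \<open>V'\<close>
    brings \<open>(T ^^ n) u\<close> close to \<open>z\<close> and into \<open>V\<close> after
    \<open>m\<close> more steps.\<close>
  define U' where "U' = ball 0 d \<inter> (T ^^ m) -` W"
  define V' where "V' = ball z (e/2) \<inter> (T ^^ m) -` V"
  have "0 \<in> U'"
    using W(2) d(1) T0 by (simp add: U'_def)
  moreover have "open U'"
    unfolding U'_def using open_vimage_funpow[OF T W(1)] by blast
  ultimately have "opene U'"
    by (auto simp: opene_def)
  moreover have "opene V'"
    using open_vimage_funpow[OF T, of V m] V y
    by (auto simp: opene_def V'_def)
  ultimately have "visit_times T x (ball z (e/2)) \<inter> return_times T U' V' \<noteq> {}"
    using z e(1) by simp
  then obtain n u where n: "(T ^^ n) x \<in> ball z (e/2)" and u: "u \<in> U'" "(T ^^ n) u \<in> V'"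
    by (auto simp: visit_times_def in_return_times_iff)
  have "n \<in> return_times T U W"
    unfolding in_return_times_iff
  proof
    show "x - u \<in> U"
      using u(1) d by (auto simp: U'_def dist_norm intro!: subsetD[OF d(2)])
    have "dist ((T ^^ n) u) ((T ^^ n) x) < e"
      using n u(2) dist_triangle_half_r[of z _ e] by (auto simp: V'_def)
    then have "dist 0 ((T ^^ n) (x - u)) < e"
      by (simp add: dist_norm linear_simps[OF bounded_linear_funpow[OF T]])
    then show "(T ^^ n) (x - u) \<in> W"
      using e(2) by auto
  qed
  moreover have "n \<in> return_times T W V"
    unfolding in_return_times_iff
  proof
    show "(T ^^ m) u \<in> W"
      using u(1) by (simp add: U'_def)
    show "(T ^^ n) ((T ^^ m) u) \<in> V"
      using u(2) by (simp add: V'_def funpow_commute)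
  qed
  ultimately show ?thesis by blast
qed

text \<open>Transitivity ties \<open>U1\<close> to \<open>U2\<close> by \<open>T ^^ m\<close> and
  \<open>V1\<close> to \<open>V2\<close> by \<open>T ^^ k\<close>. If \<open>T ^^ n\<close> takes
  \<open>a\<close> near 0 and a small \<open>w\<close> to the target, then \<open>a + w\<close> and
  \<open>(T ^^ m) a + (T ^^ k) w\<close> serve both pairs at the same time \<open>n\<close>.\<close>

lemma weakly_mixing_if_three_open_sets:
  fixes T :: "'a::real_normed_vector \<Rightarrow> 'a"
  assumes T: "bounded_linear T"
    and trans: "\<And>U V. opene U \<Longrightarrow> opene V \<Longrightarrow> return_times T U V \<noteq> {}"
    and three: "\<And>U V W. opene U \<Longrightarrow> opene V \<Longrightarrow> open W \<Longrightarrow> 0 \<in> W \<Longrightarrow>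
      return_times T U W \<inter> return_times T W V \<noteq> {}"
  shows "weakly_mixing T"
  unfolding weakly_mixing_iff
proof (intro allI impI, elim conjE)
  fix U1 V1 U2 V2 :: "'a set"
  assume opene: "opene U1" "opene V1" "opene U2" "opene V2"
  \<comment> \<open>Each opene set contains a ball with room left for a small additive
    error.\<close>
  have shrink: "\<exists>p e. 0 < e \<and> (\<forall>a w. a \<in> ball p e \<longrightarrow> w \<in> ball 0 e \<longrightarrow> a + w \<in> S)"
    if S: "opene S" for S :: "'a set"
  proof -
    obtain p e where e: "0 < e" "ball p e \<subseteq> S"
      using S by (metis all_not_in_conv opene_def openE)
    have "a + w \<in> S" if "a \<in> ball p (e/2)" "w \<in> ball 0 (e/2)" for a w
    proof -
      have "dist p (a + w) \<le> dist p a + dist a (a + w)"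
        by (rule dist_triangle)
      also have "\<dots> < e"
        using that by (simp add: dist_norm)
      finally show ?thesis using e by auto
    qed
    then show ?thesis
      using e(1) by (intro exI[of _ p] exI[of _ "e/2"]) auto
  qed
  obtain p1 a1 where U1: "0 < a1" "\<And>a w. a \<in> ball p1 a1 \<Longrightarrow> w \<in> ball 0 a1 \<Longrightarrow> a + w \<in> U1"
    using shrink[OF opene(1)] by blast
  obtain q1 b1 where V1: "0 < b1" "\<And>a w. a \<in> ball q1 b1 \<Longrightarrow> w \<in> ball 0 b1 \<Longrightarrow> a + w \<in> V1"
    using shrink[OF opene(2)] by blast
  obtain p2 a2 where U2: "0 < a2" "\<And>a w. a \<in> ball p2 a2 \<Longrightarrow> w \<in> ball 0 a2 \<Longrightarrow> a + w \<in> U2"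
    using shrink[OF opene(3)] by blast
  obtain q2 b2 where V2: "0 < b2" "\<And>a w. a \<in> ball q2 b2 \<Longrightarrow> w \<in> ball 0 b2 \<Longrightarrow> a + w \<in> V2"
    using shrink[OF opene(4)] by blast
  obtain m y where y: "y \<in> ball p1 a1" "(T ^^ m) y \<in> ball p2 a2"
    using trans[OF opene_ball[OF U1(1)] opene_ball[OF U2(1)]]
    unfolding return_times_nonempty_iff by blast
  obtain k y' where y': "y' \<in> ball q1 b1" "(T ^^ k) y' \<in> ball q2 b2"
    using trans[OF opene_ball[OF V1(1)] opene_ball[OF V2(1)]]
    unfolding return_times_nonempty_iff by blast
  define W where "W = ball (0::'a) a1 \<inter> ball 0 b1 \<inter> (ball 0 a2 \<inter> ball 0 b2)"
  \<comment> \<open>The preimages keep the errors \<open>(T ^^ k) w\<close> and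
    \<open>(T ^^ m) ((T ^^ n) a)\<close> of the second pair small as well.\<close>
  define W' where "W' = W \<inter> (T ^^ m) -` W \<inter> (T ^^ k) -` W"
  define U where "U = ball p1 a1 \<inter> (T ^^ m) -` ball p2 a2"
  define V where "V = ball q1 b1 \<inter> (T ^^ k) -` ball q2 b2"
  have T0: "(T ^^ i) 0 = 0" for i
    using bounded_linear_funpow[OF T] by (simp add: linear_simps)
  have W: "open W" "0 \<in> W"
    using U1(1) U2(1) V1(1) V2(1) by (auto simp: W_def)
  have "open W'" "0 \<in> W'"
    using W T0 by (auto simp: W'_def intro!: open_vimage_funpow[OF T])
  moreover have "opene U" "opene V"
    using y y' open_vimage_funpow[OF T open_ball, of m p2 a2]
      open_vimage_funpow[OF T open_ball, of k q2 b2]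
    by (auto simp: opene_def U_def V_def)
  ultimately have "return_times T U W' \<inter> return_times T W' V \<noteq> {}"
    by (intro three)
  then obtain n a w where a: "a \<in> U" "(T ^^ n) a \<in> W'" and w: "w \<in> W'" "(T ^^ n) w \<in> V"
    unfolding return_times_Int_nonempty_iff by blast
  note add = linear_simps(1)[OF bounded_linear_funpow[OF T]]
  have "n \<in> return_times T U1 V1"
    unfolding in_return_times_iff
  proof
    show "a + w \<in> U1"
      using a(1) w(1) by (intro U1) (auto simp: U_def W'_def W_def)
    have "(T ^^ n) w + (T ^^ n) a \<in> V1"
      using a(2) w(2) by (intro V1) (auto simp: V_def W'_def W_def)
    then show "(T ^^ n) (a + w) \<in> V1"
      by (simp add: add add.commute)
  qed
  moreover have "n \<in> return_times T U2 V2"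
    unfolding in_return_times_iff
  proof
    show "(T ^^ m) a + (T ^^ k) w \<in> U2"
      using a(1) w(1) by (intro U2) (auto simp: U_def W'_def W_def)
    \<comment> \<open>The first summand is the main term near \<open>q2\<close>, the second the
      error; powers of \<open>T\<close> commute, so this is the image of the witness.\<close>
    have "(T ^^ k) ((T ^^ n) w) + (T ^^ m) ((T ^^ n) a) \<in> V2"
      using a(2) w(2) by (intro V2) (auto simp: V_def W'_def W_def)
    then show "(T ^^ n) ((T ^^ m) a + (T ^^ k) w) \<in> V2"
      by (simp add: add add.commute funpow_commute[of n])
  qed
  ultimately show "return_times T U1 V1 \<inter> return_times T U2 V2 \<noteq> {}"
    by blast
qed

theorem theorem7p1:
  fixes T :: "'a::banach \<Rightarrow> 'a"
  assumes "infinite_dimensional TYPE('a)"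
    and "separable_type TYPE('a)"
    and "bounded_linear T"
  shows "weakly_mixing T \<longleftrightarrow> weakly_transitive_compact T"
proof
  assume "weakly_mixing T"
  with assms show "weakly_transitive_compact T"
    by (intro weakly_transitive_compact_if_weakly_mixing)
next
  assume wtc: "weakly_transitive_compact T"
  show "weakly_mixing T"
    using assms(3) transitive_if_weakly_transitive_compact[OF wtc]
      three_open_sets_if_weakly_transitive_compact[OF assms(3) wtc]
    by (rule weakly_mixing_if_three_open_sets)
qed

end
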